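(* Suppose $U=\{u\in\mathbb{R}^l: Du\le d,\ u\ge 0\}$ is a (nonempty) polytope, and suppose there exists $x\in X$ such that $Y(x,u)\neq\emptyset$ for every $u\in U$. Let $\mathcal F_1$ be a fast feasibility oracle and $\mathcal F_2$ an exact feasibility oracle (as defined in the context). Then the Duality Driven Bender Decomposition algorithm (DDBD, described in the context) run with $\mathcal F_1$ and $\mathcal F_2$ terminates in a finite number of steps and returns an optimal solution of the two-stage problem $$\min_{x\in X}\ \max_{u\in U}\ \min_{y\in Y(x,u)}\ a^Tx+b^Ty .$$
   Context: Data: $X\subseteq\mathbb{R}^{n_1}\times\mathbb{Z}^{n_2}$, $n=n_1+n_2$, $a\in\mathbb{R}^n$, $b\in\mathbb{R}^m$, $A\in\mathbb{R}^{r\times n}$, $B\in\mathbb{R}^{r\times m}$, $C\in\mathbb{R}^{r\times l}$, $c\in\mathbb{R}^r$, $D\in\mathbb{R}^{d\times l}$, and right-hand side vector $d\in\mathbb{R}^d$ (the symbol $d$ also denotes the number of rows of $D$). Put $Y(x,u)=\{y\in\mathbb{R}^m: y\ge 0,\ Ax+By+Cu\ge c\}$. Minimum over the empty set is $+\infty$, maximum over the empty set is $-\infty$. Standing assumption: the two-stage problem is bounded, i.e. its optimal value is $>-\infty$ (in particular $\overline Z(x)>-\infty$ for every $x\in X$, with $\overline Z$ below). For $x\in X$ and finite $V=\{u^0,\dots,u^k\}\subseteq U$ let $$\underline Z(x,V)=\min_{\theta,\,y^0,\dots,y^k}\{a^Tx+\theta:\ b^Ty^s\le\theta,\ Ax+By^s+Cu^s\ge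 c,\ y^s\ge 0,\ s=0,\dots,k\},$$ so $\underline Z(x,\{u\})=a^Tx+\min_{y\in Y(x,u)}b^Ty$, and let $\overline Z(x)=\max_{u\in U}\underline Z(x,\{u\})$. A decision $x\in X$ is feasible if $Y(x,u)\ne\emptyset$ for all $u\in U$, equivalently $\overline Z(x)<\infty$. Let $$\tilde Z(x)=a^Tx+\max\{b^Ty:\ u\in U,\ y\in\mathbb{R}^m_+,\ w\in\mathbb{R}^r_+,\ Ax+By+Cu\ge c,\ B^Tw\le b,\ w^T(Ax+By+Cu-c)=0,\ y^T(b-B^Tw)=0\}.$$ (If $x$ is feasible then $\tilde Z(x)=\overline Z(x)$.) Fast feasibility oracle $\mathcal F_1$: given $x\in X$, returns a vertex $u^{\mathcal F}(x)$ of the polytope $U$ such that $\tilde Z(x)\le\underline Z(x,\{u^{\mathcal F}(x)\})\le\overline Z(x)$. Exact feasibility oracle $\mathcal F_2$: given $x\in X$, determines whether $x$ is feasible and returns $\overline u(x)\in U$ with $\underline Z(x,\{\overline u(x)\})=\overline Z(x)$; when $x$ is infeasible, $\overline u(x)$ is a vertex of $U$ (so $\underline Z(x,\{\overline u(x)\})=\infty$). DDBD algorithm: (1) Input: the data and some $u^0\in U$. (2) Set $UB^0=\infty$, $LB^0=-\infty$, $V^0=\{u^0\}$, $k=0$. (3) While $LB^k<UB^k$: (a) $k\leftarrow k+1$; (b) compute $x^k\in\arg\min_{x\in X}\underline Z(x,V^{k-1})$ (a minimizer is presumed to exist) and $LB^k=\underline Z(x^k,V^{k-1})$; (c) compute $u^k=\mathcal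 F_1(x^k)$ and $UB^k=\underline Z(x^k,\{u^k\})$; (d) $V^k\leftarrow V^{k-1}\cup\{u^k\}$. (4) Compute $\overline u(x^k)=\mathcal F_2(x^k)$ and $\overline Z(x^k)=\underline Z(x^k,\{\overline u(x^k)\})$. If $\overline Z(x^k)=\infty$, set $V^k\leftarrow V^k\cup\{\overline u(x^k)\}$ and $UB^k=\infty$ and go to step (3). Otherwise return $x^k$ and $\overline Z(x^k)$. *)

theory Defs
  imports "HOL-Analysis.Analysis"
begin

text \<open>
  Problem data.  The decision space \<open>\<real>\<^sup>n\<^sup>1 \<times> \<int>\<^sup>n\<^sup>2\<close> is represented by
  \<^typ>\<open>real ^ 'n\<close> together with the set \<open>int_coords\<close> of those coordinates that are
  restricted to integers (see \<open>mixed_integer\<close>), so that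
  \<open>n\<^sub>2 = card int_coords\<close>, and either of \<open>n\<^sub>1\<close>, \<open>n\<^sub>2\<close> may be zero.
\<close>

record ('n, 'm, 'r, 'l, 'd) problem =
  int_coords :: "'n set"
  decisions :: "(real ^ 'n) set"
  cost_x :: "real ^ 'n"
  cost_y :: "real ^ 'm"
  mat_A :: "real ^ 'n ^ 'r"
  mat_B :: "real ^ 'm ^ 'r"
  mat_C :: "real ^ 'l ^ 'r"
  rhs_c :: "real ^ 'r"
  mat_D :: "real ^ 'l ^ 'd"
  rhs_d :: "real ^ 'd"

definition mixed_integer ::
  "('n::finite, 'm::finite, 'r::finite, 'l::finite, 'd::finite) problem \<Rightarrow> bool" where
  "mixed_integer P \<longleftrightarrow> (\<forall>x\<in>decisions P. \<forall>j\<in>int_coords P. x $ j \<in> \<int>)"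

text \<open>The order on \<^typ>\<open>real ^ 'n\<close> is the componentwise one.\<close>

definition uncertainty_set ::
  "('n::finite, 'm::finite, 'r::finite, 'l::finite, 'd::finite) problem \<Rightarrow> (real ^ 'l) set" where
  "uncertainty_set P = {u. mat_D P *v u \<le> rhs_d P \<and> 0 \<le> u}"

definition recourse ::
  "('n::finite, 'm::finite, 'r::finite, 'l::finite, 'd::finite) problem
    \<Rightarrow> real ^ 'n \<Rightarrow> real ^ 'l \<Rightarrow> (real ^ 'm) set" where
  "recourse P x u = {y. 0 \<le> y \<and> rhs_c P \<le> mat_A P *v x + mat_B P *v y + mat_C P *v u}"

definition feasible ::
  "('n::finite, 'm::finite, 'r::finite, 'l::finite, 'd::finite) problem \<Rightarrow> real ^ 'n \<Rightarrow> bool" where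
  "feasible P x \<longleftrightarrow> (\<forall>u\<in>uncertainty_set P. recourse P x u \<noteq> {})"

text \<open>
  Minima and maxima are taken as infima and suprema in \<^typ>\<open>ereal\<close>; this yields
  \<open>\<infinity>\<close> for a minimum and \<open>-\<infinity>\<close> for a maximum over the empty set, and \<open>\<mp>\<infinity>\<close> for
  unbounded programs.
\<close>

definition worst_case_cost ::
  "('n::finite, 'm::finite, 'r::finite, 'l::finite, 'd::finite) problem \<Rightarrow> real ^ 'n \<Rightarrow> ereal" where
  "worst_case_cost P x =
    (SUP u\<in>uncertainty_set P. INF y\<in>recourse P x u. ereal (cost_x P \<bullet> x + cost_y P \<bullet> y))"

definition optimal_value ::
  "('n::finite, 'm::finite, 'r::finite, 'l::finite, 'd::finite) problem \<Rightarrow> ereal" where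
  "optimal_value P = (INF x\<in>decisions P. worst_case_cost P x)"

definition optimal_solution ::
  "('n::finite, 'm::finite, 'r::finite, 'l::finite, 'd::finite) problem \<Rightarrow> real ^ 'n \<Rightarrow> bool" where
  "optimal_solution P x \<longleftrightarrow> is_arg_min (worst_case_cost P) (\<lambda>x. x \<in> decisions P) x"

text \<open>
  The recourse vectors \<open>y\<^sup>s\<close> belonging to the scenarios \<open>u\<^sup>s \<in> V\<close> are given as a function on
  scenarios, whose values outside \<open>V\<close> are irrelevant.
\<close>

definition Z_lower ::
  "('n::finite, 'm::finite, 'r::finite, 'l::finite, 'd::finite) problem
    \<Rightarrow> real ^ 'n \<Rightarrow> (real ^ 'l) set \<Rightarrow> ereal" where
  "Z_lower P x V =
    Inf {ereal (cost_x P \<bullet> x + \<theta>) |\<theta> y.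
           \<forall>u\<in>V. cost_y P \<bullet> y u \<le> \<theta>
             \<and> rhs_c P \<le> mat_A P *v x + mat_B P *v y u + mat_C P *v u
             \<and> 0 \<le> y u}"

definition Z_upper ::
  "('n::finite, 'm::finite, 'r::finite, 'l::finite, 'd::finite) problem \<Rightarrow> real ^ 'n \<Rightarrow> ereal" where
  "Z_upper P x = (SUP u\<in>uncertainty_set P. Z_lower P x {u})"

definition Z_tilde ::
  "('n::finite, 'm::finite, 'r::finite, 'l::finite, 'd::finite) problem \<Rightarrow> real ^ 'n \<Rightarrow> ereal" where
  "Z_tilde P x = ereal (cost_x P \<bullet> x) +
    Sup {ereal (cost_y P \<bullet> y) |u y w.
           u \<in> uncertainty_set P \<and> 0 \<le> y \<and> 0 \<le> w
           \<and> rhs_c P \<le> mat_A P *v x + mat_B P *v y + mat_C P *v u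
           \<and> transpose (mat_B P) *v w \<le> cost_y P
           \<and> w \<bullet> (mat_A P *v x + mat_B P *v y + mat_C P *v u - rhs_c P) = 0
           \<and> y \<bullet> (cost_y P - transpose (mat_B P) *v w) = 0}"

definition fast_oracle ::
  "('n::finite, 'm::finite, 'r::finite, 'l::finite, 'd::finite) problem
    \<Rightarrow> (real ^ 'n \<Rightarrow> real ^ 'l) \<Rightarrow> bool" where
  "fast_oracle P F1 \<longleftrightarrow>
    (\<forall>x\<in>decisions P. F1 x extreme_point_of uncertainty_set P
       \<and> Z_tilde P x \<le> Z_lower P x {F1 x} \<and> Z_lower P x {F1 x} \<le> Z_upper P x)"

text \<open>The Boolean component of the answer is the verdict on feasibility.\<close>

definition exact_oracle ::
  "('n::finite, 'm::finite, 'r::finite, 'l::finite, 'd::finite) problem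
    \<Rightarrow> (real ^ 'n \<Rightarrow> bool \<times> (real ^ 'l)) \<Rightarrow> bool" where
  "exact_oracle P F2 \<longleftrightarrow>
    (\<forall>x\<in>decisions P.
       (fst (F2 x) \<longleftrightarrow> feasible P x)
       \<and> snd (F2 x) \<in> uncertainty_set P
       \<and> Z_lower P x {snd (F2 x)} = Z_upper P x
       \<and> (\<not> feasible P x \<longrightarrow> snd (F2 x) extreme_point_of uncertainty_set P))"

text \<open>
  \<open>Loop k x LB UB V\<close> is the state in which the loop condition \<open>LB < UB\<close> is about to be tested,
  with \<open>x = None\<close> as long as no iterate has been computed; \<open>Returned x z\<close> is the final state.
  The choice of a minimizer in the master problem is left nondeterministic.
\<close>

datatype ('n, 'l) ddbd_state =
    Loop nat "(real ^ 'n) option" ereal ereal "(real ^ 'l) set"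
  | Returned "real ^ 'n" ereal

definition master_minimizer ::
  "('n::finite, 'm::finite, 'r::finite, 'l::finite, 'd::finite) problem
    \<Rightarrow> (real ^ 'l) set \<Rightarrow> real ^ 'n \<Rightarrow> bool" where
  "master_minimizer P V x \<longleftrightarrow> is_arg_min (\<lambda>x. Z_lower P x V) (\<lambda>x. x \<in> decisions P) x"

definition ddbd_init :: "real ^ 'l \<Rightarrow> ('n::finite, 'l::finite) ddbd_state" where
  "ddbd_init u0 = Loop 0 None (-\<infinity>) \<infinity> {u0}"

inductive ddbd_step ::
  "('n::finite, 'm::finite, 'r::finite, 'l::finite, 'd::finite) problem
    \<Rightarrow> (real ^ 'n \<Rightarrow> real ^ 'l) \<Rightarrow> (real ^ 'n \<Rightarrow> bool \<times> (real ^ 'l))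
    \<Rightarrow> ('n, 'l) ddbd_state \<Rightarrow> ('n, 'l) ddbd_state \<Rightarrow> bool"
  for P F1 F2 where
  iterate: "\<lbrakk>LB < UB; master_minimizer P V x'\<rbrakk> \<Longrightarrow>
    ddbd_step P F1 F2 (Loop k x LB UB V)
      (Loop (Suc k) (Some x') (Z_lower P x' V) (Z_lower P x' {F1 x'}) (V \<union> {F1 x'}))"
| resume: "\<lbrakk>\<not> LB < UB; Z_lower P x {snd (F2 x)} = \<infinity>\<rbrakk> \<Longrightarrow>
    ddbd_step P F1 F2 (Loop k (Some x) LB UB V)
      (Loop k (Some x) LB \<infinity> (V \<union> {snd (F2 x)}))"
| return: "\<lbrakk>\<not> LB < UB; Z_lower P x {snd (F2 x)} \<noteq> \<infinity>\<rbrakk> \<Longrightarrow>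
    ddbd_step P F1 F2 (Loop k (Some x) LB UB V)
      (Returned x (Z_lower P x {snd (F2 x)}))"

definition ddbd_reachable ::
  "('n::finite, 'm::finite, 'r::finite, 'l::finite, 'd::finite) problem
    \<Rightarrow> (real ^ 'n \<Rightarrow> real ^ 'l) \<Rightarrow> (real ^ 'n \<Rightarrow> bool \<times> (real ^ 'l)) \<Rightarrow> real ^ 'l
    \<Rightarrow> ('n, 'l) ddbd_state \<Rightarrow> bool" where
  "ddbd_reachable P F1 F2 u0 s \<longleftrightarrow> (ddbd_step P F1 F2)\<^sup>*\<^sup>* (ddbd_init u0) s"

end

theory Submission
  imports Defs
begin

text \<open>
  Correctness rests on two facts about the bounds.  Each master problem relaxes the two-stage
  problem, so \<open>LB\<close> never exceeds the optimal value (\<open>master_value_le_optimal_value\<close>).  And for a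
  feasible decision \<open>x\<close> of a bounded problem the fast oracle is exact: \<open>Z_upper P x \<le> Z_tilde P x\<close>
  (\<open>Z_upper_le_Z_tilde\<close>), which is strong linear programming duality.  For a fixed scenario, a
  feasible recourse vector and a feasible dual vector are both optimal iff they satisfy the
  complementarity conditions in the definition of \<open>Z_tilde\<close>, so maximizing over complementary pairs and
  scenarios yields the worst case.  Consequently, if the loop stops at a decision whose
  infeasibility is not detected afterwards, then its worst-case cost is \<open>UB \<le> LB\<close> and hence
  optimal (\<open>optimal_if_fast_value_le\<close>).  Duality is derived from Farkas' lemma
  (\<open>farkas_cone\<close>, \<open>dual_certificate\<close>, \<open>lp_complementary_slackness\<close>).

  Termination holds because only finitely many scenarios can enter \<open>V\<close>, namely \<open>u0\<close> and the
  vertices of the uncertainty polytope, and \<open>V\<close> can stay unchanged only in an iteration that makes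
  the loop condition false.  In more detail, when the fast oracle repeats a scenario of \<open>V\<close>, its value
  is at most \<open>LB\<close>; and when the exact oracle resumes the loop, its scenario has infinite value at
  the current decision, whereas all scenarios in \<open>V\<close> have finite values there.  The latter uses
  that the optimal value is finite: recourse is convex in the scenario, so a feasible decision has
  finite worst-case cost on a polytope (\<open>Z_upper_finite_if_feasible\<close>).  Both observations are
  combined into a decreasing natural number (\<open>progress_rank_decreases\<close>).
\<close>

section \<open>Linear programming duality\<close>

text \<open>
  A form of Farkas' lemma.  The polytope spanned by \<open>0\<close> and \<open>S\<close> is an intersection of finitely many halfspaces \<open>a \<bullet> x \<le> b\<close> with
  \<open>b \<ge> 0\<close>.  If every functional that is nonnegative on \<open>S\<close> were nonnegative at \<open>z\<close>, then the
  point \<open>t z\<close> would satisfy each of these inequalities for small \<open>t > 0\<close>: those with \<open>b = 0\<close> by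
  assumption, those with \<open>b > 0\<close> by continuity.  So \<open>t z\<close>, and after rescaling \<open>z\<close>, would lie in
  the cone.  Working with the halfspaces of a polytope avoids proving that finitely generated cones are
  closed, as a separation argument would require.
\<close>

lemma farkas_cone:
  fixes S :: "'a::euclidean_space set"
  assumes K: "convex K" "cone K" "0 \<in> K" and S: "finite S" "S \<subseteq> K" and "z \<notin> K"
  obtains h where "\<And>s. s \<in> S \<Longrightarrow> 0 \<le> h \<bullet> s" and "h \<bullet> z < 0"
proof -
  let ?P = "convex hull (insert 0 S)"
  have "polyhedron ?P"
    using S(1) by (simp add: polyhedron_convex_hull)
  then obtain F where F: "finite F" "?P = \<Inter> F"
    and halfspace: "\<And>H. H \<in> F \<Longrightarrow> \<exists>a b. H = {x. a \<bullet> x \<le> b}"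
    unfolding polyhedron_def by metis
  show thesis
  proof (rule ccontr)
    assume "\<not> thesis"
    then have dual: "0 \<le> h \<bullet> z" if "\<And>s. s \<in> S \<Longrightarrow> 0 \<le> h \<bullet> s" for h
      using that \<open>\<And>h. \<lbrakk>\<And>s. s \<in> S \<Longrightarrow> 0 \<le> h \<bullet> s; h \<bullet> z < 0\<rbrakk> \<Longrightarrow> thesis\<close> by force
    have "\<forall>\<^sub>F t in at_right 0. t *\<^sub>R z \<in> H" if "H \<in> F" for H
    proof -
      obtain a b where H: "H = {x. a \<bullet> x \<le> b}"
        using halfspace \<open>H \<in> F\<close> by blast
      have in_H: "a \<bullet> x \<le> b" if "x \<in> insert 0 S" for x
        using that hull_subset[of "insert 0 S" convex] F(2) \<open>H \<in> F\<close> H by blast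
      then have "0 \<le> b"
        by fastforce
      show ?thesis
      proof (cases "b = 0")
        case True
        then have "a \<bullet> z \<le> 0"
          using dual[of "-a"] in_H by simp
        then show ?thesis
          unfolding H True
          by (auto intro!: eventually_at_rightI[of 0 1] mult_nonneg_nonpos)
      next
        case False
        have "((\<lambda>t. a \<bullet> (t *\<^sub>R z)) \<longlongrightarrow> a \<bullet> (0 *\<^sub>R z)) (at_right 0)"
          by (intro tendsto_intros)
        then have "\<forall>\<^sub>F t in at_right 0. a \<bullet> (t *\<^sub>R z) < b"
          by (rule order_tendstoD) (use False \<open>0 \<le> b\<close> in simp)
        then show ?thesis
          unfolding H by eventually_elim simp
      qed
    qed
    then have "\<forall>\<^sub>F t in at_right (0::real). t *\<^sub>R z \<in> ?P"
      using F eventually_ball_finite[of F "\<lambda>t H. t *\<^sub>R z \<in> H" "at_right 0"] by simp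
    then have "\<forall>\<^sub>F t in at_right (0::real). 0 < t \<and> t *\<^sub>R z \<in> ?P"
      using eventually_at_right_less by (rule eventually_conj[rotated])
    then obtain t :: real where t: "0 < t" "t *\<^sub>R z \<in> ?P"
      using eventually_happens'[OF trivial_limit_at_right_real] by blast
    have "?P \<subseteq> K"
      using K S by (intro hull_minimal) auto
    then have "(1 / t) *\<^sub>R (t *\<^sub>R z) \<in> K"
      using t \<open>cone K\<close> unfolding cone_def by (meson divide_nonneg_pos subsetD zero_le_one)
    then show False
      using t \<open>z \<notin> K\<close> by simp
  qed
qed

text \<open>
  The duals below speak of \<open>transpose B *v w\<close>, which should not be rewritten to \<open>w v* B\<close>.
\<close>

declare transpose_matrix_vector [simp del]

lemma inner_transpose: "(y::real^'m) \<bullet> (transpose B *v (w::real^'r)) = w \<bullet> (B *v y)"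
  by (metis dot_lmul_matrix inner_commute transpose_matrix_vector)

text \<open>
  The affine form of Farkas' lemma: every lower bound \<open>p\<close> of a feasible linear program is
  certified by a dual solution.  The cone \<open>?K\<close> in the proof consists of the pairs
  (cost vector, lower bound) that have a certificate; it contains the rows of the constraints
  and the directions in which a certificate stays valid (a larger cost, a smaller bound).  A
  functional \<open>(y, - \<sigma>)\<close> separating \<open>(b, p)\<close> from these directions is a solution \<open>y\<close> of
  the constraints with right-hand side scaled by \<open>\<sigma>\<close> and cost below \<open>\<sigma> p\<close>.
\<close>

lemma dual_certificate:
  fixes B :: "real ^ 'm ^ 'r"
  assumes "0 \<le> y0" "q \<le> B *v y0"
    and bound: "\<And>y. \<lbrakk>0 \<le> y; q \<le> B *v y\<rbrakk> \<Longrightarrow> p \<le> b \<bullet> y"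
  obtains w where "0 \<le> w" "transpose B *v w \<le> b" "p \<le> q \<bullet> w"
proof -
  let ?K = "{(v, \<rho>). \<exists>w\<ge>0. transpose B *v w \<le> v \<and> \<rho> \<le> q \<bullet> w}"
  let ?S = "range (\<lambda>i. (transpose B *v axis i 1, q $ i)) \<union> range (\<lambda>j. (axis j 1, 0)) \<union> {(0, -1)}"
  have "(b, p) \<in> ?K"
  proof (rule ccontr)
    assume notin: "(b, p) \<notin> ?K"
    have add: "x + x' \<in> ?K" if x: "x \<in> ?K" and x': "x' \<in> ?K" for x x'
    proof -
      obtain v \<rho> w where "x = (v, \<rho>)" and w: "0 \<le> w" "transpose B *v w \<le> v" "\<rho> \<le> q \<bullet> w"
        using x by blast
      moreover obtain v' \<rho>' w' where "x' = (v', \<rho>')"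
        and w': "0 \<le> w'" "transpose B *v w' \<le> v'" "\<rho>' \<le> q \<bullet> w'"
        using x' by blast
      moreover have "0 \<le> w + w' \<and> transpose B *v (w + w') \<le> v + v' \<and> \<rho> + \<rho>' \<le> q \<bullet> (w + w')"
        using w w' by (simp add: matrix_vector_right_distrib inner_add_right add_mono)
      ultimately show ?thesis
        by (auto intro!: exI[of _ "w + w'"])
    qed
    have scale: "c *\<^sub>R x \<in> ?K" if x: "x \<in> ?K" and c: "0 \<le> c" for x c
    proof -
      obtain v \<rho> w where "x = (v, \<rho>)" and w: "0 \<le> w" "transpose B *v w \<le> v" "\<rho> \<le> q \<bullet> w"
        using x by blast
      moreover have "0 \<le> c *\<^sub>R w \<and> transpose B *v (c *\<^sub>R w) \<le> c *\<^sub>R v \<and> c * \<rho> \<le> q \<bullet> (c *\<^sub>R w)"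
        using w c by (simp add: matrix_vector_mult_scaleR scaleR_nonneg_nonneg scaleR_left_mono mult_left_mono)
      ultimately show ?thesis
        by (auto intro!: exI[of _ "c *\<^sub>R w"])
    qed
    have cone: "convex ?K \<and> cone ?K"
      unfolding convex_cone using add scale by (intro conjI ballI allI impI)
    have zero: "0 \<in> ?K"
      by (auto simp: zero_prod_def intro!: exI[of _ 0])
    have "(transpose B *v axis i 1, q $ i) \<in> ?K" for i
      by (auto simp: inner_axis intro!: exI[of _ "axis i 1"])
    moreover have "(axis j 1, 0) \<in> ?K" for j
      by (auto intro!: exI[of _ 0])
    moreover have "(0, -1) \<in> ?K"
      by (auto intro!: exI[of _ 0])
    ultimately have "?S \<subseteq> ?K"
      by (intro Un_least image_subsetI) simp_all
    then obtain h where h: "\<And>s. s \<in> ?S \<Longrightarrow> 0 \<le> h \<bullet> s" "h \<bullet> (b, p) < 0"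
      using farkas_cone[of ?K ?S "(b, p)"] cone zero notin by auto
    obtain y \<sigma> where y\<sigma>: "h = (y, - \<sigma>)"
      by (metis minus_minus surj_pair)
    have "0 \<le> y $ j" for j
      using h(1)[of "(axis j 1, 0)"] by (simp add: y\<sigma> inner_axis)
    then have y: "0 \<le> y"
      by (simp add: less_eq_vec_def)
    have \<sigma>: "0 \<le> \<sigma>"
      using h(1)[of "(0, -1)"] by (simp add: y\<sigma>)
    have "\<sigma> * q $ i \<le> (B *v y) $ i" for i
      using h(1)[of "(transpose B *v axis i 1, q $ i)"]
      by (simp add: y\<sigma> inner_transpose inner_axis')
    then have By: "\<sigma> *\<^sub>R q \<le> B *v y"
      by (simp add: less_eq_vec_def)
    have cost: "b \<bullet> y < \<sigma> * p"
      using h(2) by (simp add: y\<sigma> inner_commute mult.commute)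
    show False
    proof (cases "\<sigma> = 0")
      case True
      \<comment> \<open>\<open>y\<close> is a direction of recession with negative cost, so moving far enough from \<open>y0\<close>
        along it violates the bound.\<close>
      have ray: "p \<le> b \<bullet> y0 + t * (b \<bullet> y)" if "0 \<le> t" for t
      proof -
        have "q + 0 \<le> B *v y0 + t *\<^sub>R (B *v y)"
          using By True that assms by (intro add_mono scaleR_nonneg_nonneg) auto
        then have "p \<le> b \<bullet> (y0 + t *\<^sub>R y)"
          using y that assms by (intro bound add_nonneg_nonneg scaleR_nonneg_nonneg)
             (auto simp: matrix_vector_right_distrib matrix_vector_mult_scaleR)
        then show ?thesis by (simp add: inner_add_right)
      qed
      have neg: "b \<bullet> y < 0" using cost True by simp
      define t where "t = (\<bar>b \<bullet> y0 - p\<bar> + 1) / (- (b \<bullet> y))"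
      have "0 \<le> t" "t * (b \<bullet> y) = - (\<bar>b \<bullet> y0 - p\<bar> + 1)"
        using neg by (auto simp: t_def field_simps)
      then show False using ray[of t] by linarith
    next
      case False
      \<comment> \<open>After division by \<open>\<sigma>\<close>, \<open>y\<close> is feasible with cost below \<open>p\<close>.\<close>
      then have pos: "0 < \<sigma>" using \<sigma> by simp
      have "p \<le> b \<bullet> ((1 / \<sigma>) *\<^sub>R y)"
      proof (rule bound)
        show "0 \<le> (1 / \<sigma>) *\<^sub>R y" using y pos by (intro scaleR_nonneg_nonneg) auto
        have "(1 / \<sigma>) *\<^sub>R (\<sigma> *\<^sub>R q) \<le> (1 / \<sigma>) *\<^sub>R (B *v y)"
          using By pos by (intro scaleR_left_mono) auto
        then show "q \<le> B *v ((1 / \<sigma>) *\<^sub>R y)"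
          using pos by (simp add: matrix_vector_mult_scaleR)
      qed
      then show False using cost pos by (simp add: field_simps)
    qed
  qed
  then show thesis using that by blast
qed

lemma lp_weak_duality:
  fixes B :: "real ^ 'm ^ 'r"
  assumes "0 \<le> w" "transpose B *v w \<le> b" "0 \<le> y" "q \<le> B *v y"
  shows "q \<bullet> w \<le> b \<bullet> y"
proof -
  have "0 \<le> w \<bullet> (B *v y - q)" "0 \<le> y \<bullet> (b - transpose B *v w)"
    using assms by (auto intro!: inner_nonneg_nonneg)
  then show ?thesis
    by (simp add: inner_diff_right inner_transpose inner_commute)
qed

text \<open>
  A feasible and bounded program has a complementary pair of optimal solutions.  Certifying the
  infimum \<open>p\<close> yields an optimal dual solution \<open>w\<close>.  The dual is again a program of the same shape,
  with matrix \<open>- transpose B\<close> and, by weak duality, with lower bound \<open>- p\<close>; a certificate for that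
  bound is a primal solution \<open>y\<close> of cost at most \<open>p\<close>, so the infimum is attained.  The two
  complementarity products are nonnegative and add up to the duality gap, which is zero.
\<close>

lemma lp_complementary_slackness:
  fixes B :: "real ^ 'm ^ 'r"
  assumes "0 \<le> y0" "q \<le> B *v y0"
    and bound: "\<And>y. \<lbrakk>0 \<le> y; q \<le> B *v y\<rbrakk> \<Longrightarrow> p0 \<le> b \<bullet> y"
  obtains y w where "0 \<le> y" "q \<le> B *v y" "0 \<le> w" "transpose B *v w \<le> b"
    "w \<bullet> (B *v y - q) = 0" "y \<bullet> (b - transpose B *v w) = 0"
proof -
  let ?costs = "(\<lambda>y. b \<bullet> y) ` {y. 0 \<le> y \<and> q \<le> B *v y}"
  define p where "p = Inf ?costs"
  have bdd: "bdd_below ?costs"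
    using bound by (auto intro!: bdd_belowI[of _ p0])
  have "p \<le> b \<bullet> y" if "0 \<le> y" "q \<le> B *v y" for y
    unfolding p_def using that by (intro cINF_lower bdd) auto
  then obtain w where w: "0 \<le> w" "transpose B *v w \<le> b" "p \<le> q \<bullet> w"
    using dual_certificate[OF assms(1,2)] by metis
  let ?B = "- transpose B"
  have neg: "?B *v v = - (transpose B *v v)" "transpose ?B *v y = - (B *v y)" for v y
    by (simp_all add: vec_eq_iff matrix_vector_mult_def transpose_def sum_negf)
  have "- p \<le> (- q) \<bullet> v" if "0 \<le> v" "- b \<le> ?B *v v" for v
  proof -
    have "q \<bullet> v \<le> p"
      unfolding p_def using that assms(1,2) lp_weak_duality by (intro cINF_greatest) (auto simp: neg)
    then show ?thesis by simp
  qed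
  then obtain y where y: "0 \<le> y" "q \<le> B *v y" "b \<bullet> y \<le> p"
    using dual_certificate[of w "-b" ?B "-p" "-q"] w by (auto simp: neg)
  have "0 \<le> w \<bullet> (B *v y - q)" "0 \<le> y \<bullet> (b - transpose B *v w)"
    using w y by (auto intro!: inner_nonneg_nonneg)
  moreover have "w \<bullet> (B *v y - q) + y \<bullet> (b - transpose B *v w) \<le> 0"
    using w(3) y(3) by (simp add: inner_diff_right inner_transpose inner_commute)
  ultimately show thesis
    using w y by (intro that[of y w]) auto
qed

section \<open>Bounds on the worst-case cost of a decision\<close>

context
  fixes P :: "('n::finite, 'm::finite, 'r::finite, 'l::finite, 'd::finite) problem"
begin

lemma Z_lower_leI:
  assumes "\<And>u. u \<in> V \<Longrightarrow> \<exists>y\<in>recourse P x u. cost_x P \<bullet> x + cost_y P \<bullet> y \<le> K"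
  shows "Z_lower P x V \<le> ereal K"
proof -
  obtain y where y: "\<And>u. u \<in> V \<Longrightarrow> y u \<in> recourse P x u \<and> cost_x P \<bullet> x + cost_y P \<bullet> y u \<le> K"
    using assms by metis
  show ?thesis
    unfolding Z_lower_def
    by (intro Inf_lower CollectI exI[of _ "K - cost_x P \<bullet> x"] exI[of _ y])
      (use y in \<open>force simp: recourse_def\<close>)
qed

lemma Z_lower_mono: "V \<subseteq> W \<Longrightarrow> Z_lower P x V \<le> Z_lower P x W"
  unfolding Z_lower_def by (intro Inf_superset_mono) blast

lemma Z_lower_singleton:
  "Z_lower P x {u} = (INF y\<in>recourse P x u. ereal (cost_x P \<bullet> x + cost_y P \<bullet> y))"
proof (rule antisym)
  show "Z_lower P x {u} \<le> (INF y\<in>recourse P x u. ereal (cost_x P \<bullet> x + cost_y P \<bullet> y))"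
    by (intro INF_greatest Z_lower_leI) auto
  show "(INF y\<in>recourse P x u. ereal (cost_x P \<bullet> x + cost_y P \<bullet> y)) \<le> Z_lower P x {u}"
    unfolding Z_lower_def by (intro Inf_greatest) (auto simp: recourse_def intro!: INF_lower2)
qed

lemma worst_case_cost_eq_Z_upper: "worst_case_cost P x = Z_upper P x"
  unfolding worst_case_cost_def Z_upper_def by (simp add: Z_lower_singleton)

text \<open>
  The common value \<open>\<theta>\<close> only has to dominate the recourse costs of the scenarios in \<open>V\<close>, so any
  \<open>K\<close> above the worst case serves as \<open>\<theta>\<close> for all of them at once.  The detour through such \<open>K\<close> is
  needed because recourse vectors are only known to come arbitrarily close to the infima.
\<close>

lemma Z_lower_le_Z_upper:
  assumes "V \<subseteq> uncertainty_set P"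
  shows "Z_lower P x V \<le> Z_upper P x"
proof (rule dense_ge)
  fix K assume K: "Z_upper P x < K"
  show "Z_lower P x V \<le> K"
  proof (cases K)
    case (real k)
    have "\<exists>y\<in>recourse P x u. cost_x P \<bullet> x + cost_y P \<bullet> y \<le> k" if "u \<in> V" for u
    proof -
      have "Z_lower P x {u} \<le> Z_upper P x"
        unfolding Z_upper_def using that assms by (intro SUP_upper) auto
      then have "Z_lower P x {u} < ereal k"
        using K real by auto
      then show ?thesis
        unfolding Z_lower_singleton INF_less_iff by (auto intro: less_imp_le)
    qed
    then show ?thesis
      unfolding real by (rule Z_lower_leI)
  qed (use K in auto)
qed

lemma feasible_if_Z_upper_finite:
  assumes "Z_upper P x < \<infinity>"
  shows "feasible P x"
  unfolding feasible_def
proof (intro ballI notI)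
  fix u assume "u \<in> uncertainty_set P" "recourse P x u = {}"
  then have "Z_lower P x {u} \<le> Z_upper P x" "Z_lower P x {u} = \<infinity>"
    unfolding Z_upper_def by (auto intro: SUP_upper) (simp add: Z_lower_singleton top_ereal_def)
  then show False
    using assms by simp
qed

text \<open>
  A recourse vector at a convex combination of scenarios is obtained by combining recourse vectors
  at these scenarios.  Hence the scenarios that admit recourse at cost at most \<open>K\<close> form a convex
  set, and a bound \<open>K\<close> for the finitely many generators of the polytope is a bound everywhere.
\<close>

lemma Z_upper_finite_if_feasible:
  assumes "polytope (uncertainty_set P)" "feasible P x"
  shows "Z_upper P x < \<infinity>"
proof -
  obtain E where E: "finite E" "uncertainty_set P = convex hull E"
    using assms(1) unfolding polytope_def by blast
  then have "\<forall>v\<in>E. \<exists>y. y \<in> recourse P x v"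
    using assms(2) hull_subset[of E convex] unfolding feasible_def by blast
  then obtain y where y: "\<And>v. v \<in> E \<Longrightarrow> y v \<in> recourse P x v"
    by metis
  define K where "K = Max (insert 0 ((\<lambda>v. cost_x P \<bullet> x + cost_y P \<bullet> y v) ` E))"
  have K: "cost_x P \<bullet> x + cost_y P \<bullet> y v \<le> K" if "v \<in> E" for v
    unfolding K_def using that E(1) by (intro Max_ge) auto
  let ?T = "{u. \<exists>y\<in>recourse P x u. cost_x P \<bullet> x + cost_y P \<bullet> y \<le> K}"
  have "convex ?T"
  proof (rule convexI, clarify)
    fix u1 u2 s t y1 y2
    assume st: "0 \<le> (s::real)" "0 \<le> t" "s + t = 1"
      and y1: "y1 \<in> recourse P x u1" "cost_x P \<bullet> x + cost_y P \<bullet> y1 \<le> K"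
      and y2: "y2 \<in> recourse P x u2" "cost_x P \<bullet> x + cost_y P \<bullet> y2 \<le> K"
    let ?y = "s *\<^sub>R y1 + t *\<^sub>R y2" and ?u = "s *\<^sub>R u1 + t *\<^sub>R u2"
    have split: "s *\<^sub>R z + t *\<^sub>R z = z" for z :: "'z::real_vector"
      using st(3) by (simp flip: scaleR_left.add)
    have "s *\<^sub>R rhs_c P + t *\<^sub>R rhs_c P
        \<le> s *\<^sub>R (mat_A P *v x + mat_B P *v y1 + mat_C P *v u1)
          + t *\<^sub>R (mat_A P *v x + mat_B P *v y2 + mat_C P *v u2)"
      using st y1 y2 by (intro add_mono scaleR_left_mono) (auto simp: recourse_def)
    also have "\<dots> = (s *\<^sub>R (mat_A P *v x) + t *\<^sub>R (mat_A P *v x)) + mat_B P *v ?y + mat_C P *v ?u"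
      by (simp add: matrix_vector_right_distrib matrix_vector_mult_scaleR algebra_simps)
    finally have "rhs_c P \<le> mat_A P *v x + mat_B P *v ?y + mat_C P *v ?u"
      unfolding split .
    moreover have "0 \<le> ?y"
      using st y1 y2 by (intro add_nonneg_nonneg scaleR_nonneg_nonneg) (auto simp: recourse_def)
    moreover have "cost_x P \<bullet> x + cost_y P \<bullet> ?y \<le> K"
    proof -
      have "s * (cost_x P \<bullet> x + cost_y P \<bullet> y1) + t * (cost_x P \<bullet> x + cost_y P \<bullet> y2) \<le> s * K + t * K"
        using st y1 y2 by (intro add_mono mult_left_mono) auto
      also have "s * K + t * K = K"
        using split[of K] by simp
      also have "s * (cost_x P \<bullet> x + cost_y P \<bullet> y1) + t * (cost_x P \<bullet> x + cost_y P \<bullet> y2)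
          = (s *\<^sub>R (cost_x P \<bullet> x) + t *\<^sub>R (cost_x P \<bullet> x)) + cost_y P \<bullet> ?y"
        by (simp add: inner_add_right algebra_simps)
      finally show ?thesis
        unfolding split .
    qed
    ultimately show "\<exists>y\<in>recourse P x ?u. cost_x P \<bullet> x + cost_y P \<bullet> y \<le> K"
      unfolding recourse_def by (intro bexI[of _ ?y]) auto
  qed
  moreover have "E \<subseteq> ?T"
    using y K by blast
  ultimately have "uncertainty_set P \<subseteq> ?T"
    unfolding E(2) by (intro hull_minimal)
  then have "Z_upper P x \<le> ereal K"
    unfolding Z_upper_def by (intro SUP_least Z_lower_leI) auto
  then show ?thesis
    by (rule le_less_trans) simp
qed

text \<open>
  The constraints on \<open>w\<close> in the dual of the recourse problem involve neither \<open>x\<close> nor \<open>u\<close>.  Since the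
  worst case is not \<open>-\<infinity>\<close>, the recourse problem of some scenario is bounded below and supplies a
  dual feasible \<open>w0\<close>, which bounds the recourse problems of all scenarios.  Each of them therefore
  has a complementary pair of optimal solutions, which is a feasible point of the program
  defining \<open>Z_tilde\<close>.
\<close>

lemma Z_upper_le_Z_tilde:
  assumes "feasible P x" "Z_upper P x > -\<infinity>"
  shows "Z_upper P x \<le> Z_tilde P x"
proof -
  let ?q = "\<lambda>u. rhs_c P - mat_A P *v x - mat_C P *v u"
  have recourse_eq: "recourse P x u = {y. 0 \<le> y \<and> ?q u \<le> mat_B P *v y}" for u
    unfolding recourse_def by (simp add: algebra_simps less_eq_vec_def)
  obtain w0 where w0: "0 \<le> w0" "transpose (mat_B P) *v w0 \<le> cost_y P"
  proof -
    obtain u where u: "u \<in> uncertainty_set P" "-\<infinity> < Z_lower P x {u}"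
      using assms(2) unfolding Z_upper_def less_SUP_iff by blast
    then obtain k where k: "ereal k < Z_lower P x {u}"
      using ereal_dense2 by blast
    obtain y where y: "y \<in> recourse P x u"
      using assms(1) u(1) unfolding feasible_def by blast
    have "k - cost_x P \<bullet> x \<le> cost_y P \<bullet> y" if "y \<in> recourse P x u" for y
    proof -
      have "Z_lower P x {u} \<le> ereal (cost_x P \<bullet> x + cost_y P \<bullet> y)"
        using that by (intro Z_lower_leI) auto
      then have "ereal k < ereal (cost_x P \<bullet> x + cost_y P \<bullet> y)"
        using k by (rule less_le_trans[rotated])
      then show ?thesis
        by simp
    qed
    then have bound: "k - cost_x P \<bullet> x \<le> cost_y P \<bullet> y" if "0 \<le> y" "?q u \<le> mat_B P *v y" for y
      using that unfolding recourse_eq by simp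
    have "0 \<le> y" "?q u \<le> mat_B P *v y"
      using y unfolding recourse_eq by simp_all
    then obtain w where "0 \<le> w" "transpose (mat_B P) *v w \<le> cost_y P"
      using bound by (rule dual_certificate)
    then show thesis
      by (rule that)
  qed
  have "Z_lower P x {u} \<le> Z_tilde P x" if u: "u \<in> uncertainty_set P" for u
  proof -
    obtain y0 where "y0 \<in> recourse P x u"
      using assms(1) u unfolding feasible_def by blast
    then have "0 \<le> y0" "?q u \<le> mat_B P *v y0"
      unfolding recourse_eq by simp_all
    then obtain y w where yw: "0 \<le> y" "?q u \<le> mat_B P *v y" "0 \<le> w"
      "transpose (mat_B P) *v w \<le> cost_y P" "w \<bullet> (mat_B P *v y - ?q u) = 0"
      "y \<bullet> (cost_y P - transpose (mat_B P) *v w) = 0"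
      using lp_weak_duality[OF w0] by (rule lp_complementary_slackness)
    have y: "y \<in> recourse P x u"
      unfolding recourse_eq using yw(1,2) by simp
    have slack_eq: "mat_B P *v y - ?q u = mat_A P *v x + mat_B P *v y + mat_C P *v u - rhs_c P"
      by (simp add: algebra_simps)
    have slack: "w \<bullet> (mat_A P *v x + mat_B P *v y + mat_C P *v u - rhs_c P) = 0"
      using yw(5) unfolding slack_eq .
    have "Z_lower P x {u} \<le> ereal (cost_x P \<bullet> x + cost_y P \<bullet> y)"
      using y by (intro Z_lower_leI) auto
    also have "\<dots> = ereal (cost_x P \<bullet> x) + ereal (cost_y P \<bullet> y)"
      by simp
    also have "\<dots> \<le> Z_tilde P x"
      unfolding Z_tilde_def
    proof (rule add_left_mono, rule Sup_upper, rule CollectI, intro exI conjI)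
      show "rhs_c P \<le> mat_A P *v x + mat_B P *v y + mat_C P *v u"
        using y unfolding recourse_def by simp
    qed (fact refl u yw(1,3,4,6) slack)+
    finally show ?thesis .
  qed
  then show ?thesis
    unfolding Z_upper_def[of P x] by (intro SUP_least)
qed

end

section \<open>The loop: correctness and progress\<close>

locale ddbd =
  fixes P :: "('n::finite, 'm::finite, 'r::finite, 'l::finite, 'd::finite) problem"
    and F1 :: "real ^ 'n \<Rightarrow> real ^ 'l"
    and F2 :: "real ^ 'n \<Rightarrow> bool \<times> (real ^ 'l)"
    and u0 :: "real ^ 'l"
  assumes polytope_U: "polytope (uncertainty_set P)"
    and bounded_below: "optimal_value P > -\<infinity>"
    and feasible_decision: "\<exists>x\<in>decisions P. feasible P x"
    and fast: "fast_oracle P F1"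
    and exact: "exact_oracle P F2"
    and u0: "u0 \<in> uncertainty_set P"
begin

text \<open>
  All scenarios that can ever enter \<open>V\<close>: besides the initial one, both oracles contribute
  only vertices, the exact oracle because it is consulted for a new scenario only when the
  decision is infeasible.
\<close>

definition scenarios :: "(real ^ 'l) set" where
  "scenarios = insert u0 {v. v extreme_point_of uncertainty_set P}"

lemma finite_scenarios: "finite scenarios"
  unfolding scenarios_def
  using finite_polyhedron_extreme_points[OF polytope_imp_polyhedron[OF polytope_U]] by simp

lemma scenarios_subset: "scenarios \<subseteq> uncertainty_set P"
  using u0 by (auto simp: scenarios_def extreme_point_of_def)

lemma optimal_value_le: "x \<in> decisions P \<Longrightarrow> optimal_value P \<le> Z_upper P x"
  unfolding optimal_value_def worst_case_cost_eq_Z_upper by (rule INF_lower)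

lemma optimal_value_finite: "optimal_value P < \<infinity>"
  using feasible_decision optimal_value_le Z_upper_finite_if_feasible[OF polytope_U]
  by (blast intro: le_less_trans)

text \<open>
  The master problem is a relaxation of the two-stage problem.
\<close>

lemma master_value_le_optimal_value:
  assumes "V \<subseteq> uncertainty_set P" "master_minimizer P V x'"
  shows "Z_lower P x' V \<le> optimal_value P"
  unfolding optimal_value_def worst_case_cost_eq_Z_upper
proof (rule INF_greatest)
  fix x assume "x \<in> decisions P"
  then have "Z_lower P x' V \<le> Z_lower P x V"
    using assms(2) unfolding master_minimizer_def is_arg_min_linorder by blast
  also have "\<dots> \<le> Z_upper P x"
    by (rule Z_lower_le_Z_upper[OF assms(1)])
  finally show "Z_lower P x' V \<le> Z_upper P x" .
qed

text \<open>
  For a decision of finite worst-case cost, the lower bound \<open>Z_tilde\<close> demanded of the fast oracle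
  is the worst-case cost itself, so the fast oracle is exact there and its value cannot undercut the
  optimal value.
\<close>

lemma optimal_if_fast_value_le:
  assumes "x \<in> decisions P" "Z_upper P x < \<infinity>" "Z_lower P x {F1 x} \<le> optimal_value P"
  shows "Z_upper P x = optimal_value P" "optimal_solution P x"
proof -
  have "Z_upper P x \<le> Z_tilde P x"
    using assms bounded_below optimal_value_le[of x]
    by (intro Z_upper_le_Z_tilde feasible_if_Z_upper_finite) auto
  also have "\<dots> \<le> Z_lower P x {F1 x}"
    using fast assms(1) unfolding fast_oracle_def by blast
  finally show "Z_upper P x = optimal_value P"
    using assms(3) optimal_value_le[OF assms(1)] by simp
  then show "optimal_solution P x"
    using assms(1) optimal_value_le
    unfolding optimal_solution_def is_arg_min_linorder worst_case_cost_eq_Z_upper by simp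
qed

text \<open>
  \<open>UB = \<infinity>\<close> also marks the states in which \<open>UB\<close> carries no information about the current
  iterate (at the start and after an infeasible iterate has been detected).  The finiteness of the
  scenario values matters for progress: it shows that a scenario exposing the current iterate as
  infeasible is new.
\<close>

fun invariant :: "('n, 'l) ddbd_state \<Rightarrow> bool" where
  "invariant (Loop k x LB UB V) \<longleftrightarrow>
    V \<subseteq> scenarios \<and> LB \<le> optimal_value P \<and>
    (case x of None \<Rightarrow> UB = \<infinity>
     | Some x \<Rightarrow> x \<in> decisions P \<and>
         (UB \<noteq> \<infinity> \<longrightarrow> UB = Z_lower P x {F1 x} \<and> (\<forall>v\<in>V. Z_lower P x {v} < \<infinity>)))"
| "invariant (Returned x z) \<longleftrightarrow> optimal_solution P x \<and> z = optimal_value P"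

lemma invariant_init: "invariant (ddbd_init u0)"
  by (simp add: ddbd_init_def scenarios_def)

text \<open>
  The loop stops only with \<open>UB \<le> LB\<close>.  As \<open>LB\<close> is at most the optimal value, which is finite since
  some decision is feasible, \<open>UB\<close> is then the fast oracle's value at the current iterate.
\<close>

lemma invariant_loop_exit:
  assumes "invariant (Loop k x LB UB V)" "\<not> LB < UB"
  obtains x' where "x = Some x'" "x' \<in> decisions P" "Z_lower P x' {F1 x'} \<le> optimal_value P"
    "\<And>v. v \<in> V \<Longrightarrow> Z_lower P x' {v} < \<infinity>"
proof -
  have "UB \<le> optimal_value P"
    using assms by auto
  then have "UB \<noteq> \<infinity>"
    using optimal_value_finite by auto
  then show thesis
    using that assms \<open>UB \<le> optimal_value P\<close> by (auto split: option.splits)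
qed

lemma exact_value:
  "x \<in> decisions P \<Longrightarrow> Z_lower P x {snd (F2 x)} = Z_upper P x"
  using exact unfolding exact_oracle_def by blast

lemma invariant_step:
  assumes "ddbd_step P F1 F2 s s'" "invariant s"
  shows "invariant s'"
  using assms
proof cases
  case (iterate LB UB V x' k x)
  have V: "V \<subseteq> scenarios"
    using iterate assms(2) by simp
  have x': "x' \<in> decisions P"
    using iterate by (simp add: master_minimizer_def is_arg_min_def)
  have LB: "Z_lower P x' V \<le> optimal_value P"
    using V scenarios_subset iterate by (intro master_value_le_optimal_value) auto
  have "Z_lower P x' {v} < \<infinity>" if "v \<in> V" for v
  proof -
    have "Z_lower P x' {v} \<le> Z_lower P x' V"
      using that by (intro Z_lower_mono) simp
    also note LB
    also note optimal_value_finite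
    finally show ?thesis .
  qed
  moreover have "F1 x' \<in> scenarios"
    using fast x' by (simp add: fast_oracle_def scenarios_def)
  \<comment> \<open>The value of the added scenario is the new \<open>UB\<close>, so it is covered by the condition
    \<open>UB \<noteq> \<infinity>\<close> of the invariant.\<close>
  ultimately show ?thesis
    using iterate V x' LB by auto
next
  case (resume LB UB x k V)
  have x: "x \<in> decisions P"
    using resume assms(2) by simp
  then have "\<not> feasible P x"
    using resume exact_value Z_upper_finite_if_feasible[OF polytope_U] by fastforce
  then have "snd (F2 x) \<in> scenarios"
    using exact x by (simp add: exact_oracle_def scenarios_def)
  then show ?thesis
    using resume assms(2) by simp
next
  case (return LB UB x k V)
  then obtain x: "x \<in> decisions P" and fast_value: "Z_lower P x {F1 x} \<le> optimal_value P"
    using invariant_loop_exit assms(2) by blast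
  then have "Z_upper P x < \<infinity>"
    using return exact_value by auto
  then show ?thesis
    using optimal_if_fast_value_le x fast_value return exact_value by simp
qed

lemma invariant_reachable: "ddbd_reachable P F1 F2 u0 s \<Longrightarrow> invariant s"
  unfolding ddbd_reachable_def
  by (induction rule: rtranclp_induct) (auto intro: invariant_init invariant_step)

text \<open>
  The weight 2 lets the gain of one scenario outweigh the truth of the loop condition, which
  may turn from false to true at the same time.
\<close>

fun progress_rank :: "('n, 'l) ddbd_state \<Rightarrow> nat" where
  "progress_rank (Loop k x LB UB V) = Suc (2 * card (scenarios - V) + of_bool (LB < UB))"
| "progress_rank (Returned x z) = 0"

lemma card_scenarios_decreases:
  assumes "v \<in> scenarios" "v \<notin> V"
  shows "card (scenarios - (V \<union> {v})) < card (scenarios - V)"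
  using assms finite_scenarios by (intro psubset_card_mono) auto

text \<open>
  If an iteration returns a scenario already in \<open>V\<close>, its value is one of the values that \<open>LB\<close>
  dominates, so \<open>UB \<le> LB\<close> and the loop condition fails.  If the return test fails, the
  scenario exposing infeasibility is new, because all scenarios in \<open>V\<close> have finite values at
  the current iterate.
\<close>

lemma progress_rank_decreases:
  assumes "ddbd_step P F1 F2 s s'" "invariant s"
  shows "progress_rank s' < progress_rank s"
  using assms
proof cases
  case (iterate LB UB V x' k x)
  show ?thesis
  proof (cases "F1 x' \<in> V")
    case True
    then have "Z_lower P x' {F1 x'} \<le> Z_lower P x' V"
      by (intro Z_lower_mono) simp
    then show ?thesis
      using iterate True by (simp add: insert_absorb)
  next
    case False
    have "F1 x' \<in> scenarios"
      using fast iterate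
      by (simp add: fast_oracle_def scenarios_def master_minimizer_def is_arg_min_def)
    then show ?thesis
      using iterate card_scenarios_decreases[OF _ False] by simp
  qed
next
  case (resume LB UB x k V)
  have "snd (F2 x) \<in> scenarios"
    using invariant_step[OF assms] resume by simp
  moreover have "snd (F2 x) \<notin> V"
  proof -
    obtain "\<And>v. v \<in> V \<Longrightarrow> Z_lower P x {v} < \<infinity>"
      using assms(2) unfolding resume(1) by (rule invariant_loop_exit) (use resume in auto)
    then show ?thesis
      using resume by fastforce
  qed
  ultimately have "card (scenarios - (V \<union> {snd (F2 x)})) < card (scenarios - V)"
    by (rule card_scenarios_decreases)
  then show ?thesis
    using resume by simp
qed simp

lemma terminates:
  assumes "\<sigma> 0 = ddbd_init u0" "\<And>i. ddbd_step P F1 F2 (\<sigma> i) (\<sigma> (Suc i))"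
  shows False
proof -
  have "invariant (\<sigma> i)" for i
    by (induction i) (use assms invariant_init invariant_step in auto)
  then have decrease: "progress_rank (\<sigma> (Suc i)) < progress_rank (\<sigma> i)" for i
    using assms(2) progress_rank_decreases by blast
  have "progress_rank (\<sigma> i) + i \<le> progress_rank (\<sigma> 0)" for i
  proof (induction i)
    case (Suc i)
    then show ?case
      using decrease[of i] by simp
  qed simp
  from this[of "Suc (progress_rank (\<sigma> 0))"] show False
    by simp
qed

lemma step_exists:
  assumes "invariant (Loop k x LB UB V)" "LB < UB \<Longrightarrow> \<exists>x'. master_minimizer P V x'"
  shows "\<exists>s'. ddbd_step P F1 F2 (Loop k x LB UB V) s'"
proof (cases "LB < UB")
  case True
  then show ?thesis
    using assms(2) ddbd_step.iterate by blast
next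
  case False
  then show ?thesis
    using invariant_loop_exit[OF assms(1)] ddbd_step.resume ddbd_step.return by metis
qed

end

theorem theorem1:
  fixes P :: "('n::finite, 'm::finite, 'r::finite, 'l::finite, 'd::finite) problem"
    and F1 :: "real ^ 'n \<Rightarrow> real ^ 'l"
    and F2 :: "real ^ 'n \<Rightarrow> bool \<times> (real ^ 'l)"
    and u0 :: "real ^ 'l"
  assumes "mixed_integer P"
    and "polytope (uncertainty_set P)" and "uncertainty_set P \<noteq> {}"
    and "optimal_value P > -\<infinity>"
    and "\<exists>x\<in>decisions P. \<forall>u\<in>uncertainty_set P. recourse P x u \<noteq> {}"
    and "fast_oracle P F1" and "exact_oracle P F2"
    and "u0 \<in> uncertainty_set P"
    and minimizer_exists: "\<And>k x LB UB V.
      \<lbrakk>ddbd_reachable P F1 F2 u0 (Loop k x LB UB V); LB < UB\<rbrakk> \<Longrightarrow> \<exists>x'. master_minimizer P V x'"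
  shows "\<not> (\<exists>\<sigma>. \<sigma> 0 = ddbd_init u0 \<and> (\<forall>i. ddbd_step P F1 F2 (\<sigma> i) (\<sigma> (Suc i))))
    \<and> (\<forall>s. ddbd_reachable P F1 F2 u0 s \<and> (\<nexists>s'. ddbd_step P F1 F2 s s') \<longrightarrow>
          (\<exists>x z. s = Returned x z \<and> optimal_solution P x \<and> z = optimal_value P))"
proof -
  interpret ddbd P F1 F2 u0
    using assms(2,4-8) by unfold_locales (auto simp: feasible_def)
  have "\<exists>x z. s = Returned x z \<and> optimal_solution P x \<and> z = optimal_value P"
    if reach: "ddbd_reachable P F1 F2 u0 s" and stuck: "\<nexists>s'. ddbd_step P F1 F2 s s'" for s
  proof (cases s)
    case (Loop k x LB UB V)
    then show ?thesis
      using step_exists[of k x LB UB V] invariant_reachable[OF reach] minimizer_exists reach stuck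
      by blast
  next
    case (Returned x z)
    then show ?thesis
      using invariant_reachable[OF reach] by simp
  qed
  then show ?thesis
    using terminates by blast
qed

end
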